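(* Let $$\mathcal J=\sum_{d_1,\dots,d_r\ge0}\ \prod_{i=1}^rQ_i^{d_i}\ \prod_{i=1}^r\prod_{a=1}^n\prod_{m=1}^{d_i}\frac{1+yq^m\frac{P_i}{t_a}}{1-q^m\frac{P_i}{t_a}}\ \prod_{\substack{i,j=1\\ i\ne j}}^r\frac{\prod_{m=-\infty}^{d_i-d_j}\big(1-q^m\lambda\frac{P_i}{P_j}\big)\prod_{m=-\infty}^{0}\big(1+yq^m\lambda\frac{P_i}{P_j}\big)}{\prod_{m=-\infty}^{0}\big(1-q^m\lambda\frac{P_i}{P_j}\big)\prod_{m=-\infty}^{d_i-d_j}\big(1+yq^m\lambda\frac{P_i}{P_j}\big)} ,$$ and define the $q$-difference operators $$\mathcal D_1^1=\prod_{j\ne 1}\big(1+y\lambda P_1P_j^{-1}q^{Q_1\partial_{Q_1}-Q_j\partial_{Q_j}}\big)\prod_{j\ne 1}\big(1-\lambda qP_jP_1^{-1}q^{Q_j\partial_{Q_j}-Q_1\partial_{Q_1}}\big)\prod_{a=1}^n\Big(1-\frac{P_1}{t_a}q^{Q_1\partial_{Q_1}}\Big),$$ $$\mathcal D_2^1=\prod_{j\ne 1}\big(1+y\lambda qP_jP_1^{-1}q^{Q_j\partial_{Q_j}-Q_1\partial_{Q_1}}\big)\prod_{a=1}^n\Big(1+y\frac{P_1}{t_a}q^{Q_1\partial_{Q_1}}\Big)\,Q_1\,\prod_{j\ne 1}\big(1-\lambda qP_1P_j^{-1}q^{Q_1\partial_{Q_1}-Q_j\partial_{Q_j}}\big),$$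 where $j$ ranges over $\{2,\dots,r\}$. Then $\mathcal D_1^1\mathcal J=\mathcal D_2^1\mathcal J$.
   Context: $P_i$ is the class of the tautological bundle $\mathcal O(-1)$ of the $i$-th factor of $(\mathbb{P}^{n-1})^r$ in $T$-equivariant $K$-theory, $T=(\mathbb{C}^* )^n$ acting diagonally with weights $t_1,\dots,t_n$; thus $P_i$ is invertible and $\prod_{a=1}^n(1-P_i/t_a)=0$. The parameters $q,\lambda,y$ are formal, and coefficients are taken in $K_T((\mathbb{P}^{n-1})^r)$ extended by $q^{\pm1},\lambda,y$ and localized so that the denominators occurring are invertible. A ratio $\prod_{m=-\infty}^{k}c_m/\prod_{m=-\infty}^0c_m$ means $\prod_{m=1}^kc_m$ if $k\ge0$ and $\prod_{m=k+1}^0c_m^{-1}$ if $k<0$. The operator $q^{\pm Q_i\partial_{Q_i}}$ acts on power series in $Q_1,\dots,Q_r$ by $Q_i\mapsto q^{\pm1}Q_i$; $Q_i$ acts by multiplication; operators in a product are composed, the rightmost acting first. $\mathcal J$ is the $\lambda_y$-balanced version (each factor $1-w$ in a numerator is replaced by $\frac{1-w}{1+yw}$, and each $\frac{1}{1-w}$ by $\frac{1+yw}{1-w}$) of a function $\overline J^{tw}$ in the twisted quantum $K$-theory of $(\mathbb{P}^{n-1})^r$, the abelianization of the Grassmannian $G(r,n)$. *)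

theory Defs
  imports
    Complex_Main
    "HOL-Library.Poly_Mapping"
    "HOL-Computational_Algebra.Polynomial"
begin

section \<open>The equivariant K-ring\<close>

text \<open>
  Factors of the product of projective spaces are indexed by a finite linearly ordered type
  \<open>'r\<close> (so r = CARD('r)), and the torus weights by a finite linearly ordered type \<open>'n\<close>
  (so n = CARD('n)). The ring is given by its standard presentation
  \<open>\<int>[t\<^sub>a\<^sup>\<plusminus>, P\<^sub>i\<^sup>\<plusminus>] / (\<Prod>\<^sub>a (1 - P\<^sub>i / t\<^sub>a))\<^sub>i\<close>. Laurent polynomials are finitely supported
  functions on integer exponent vectors.
\<close>

datatype ('n, 'r) kgen = GT 'n | GP 'r

type_synonym ('n, 'r) laurent = "(('n, 'r) kgen \<Rightarrow>\<^sub>0 int) \<Rightarrow>\<^sub>0 int"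

definition P_over_t :: "'r \<Rightarrow> 'n \<Rightarrow> ('n, 'r) kgen \<Rightarrow>\<^sub>0 int" where
  "P_over_t i a = Poly_Mapping.single (GP i) 1 - Poly_Mapping.single (GT a) 1"

definition P_over_P :: "'r \<Rightarrow> 'r \<Rightarrow> ('n, 'r) kgen \<Rightarrow>\<^sub>0 int" where
  "P_over_P i j = Poly_Mapping.single (GP i) 1 - Poly_Mapping.single (GP j) 1"

definition K_relator :: "'r \<Rightarrow> ('n::finite, 'r) laurent" where
  "K_relator i = (\<Prod>a\<in>UNIV. 1 - Poly_Mapping.single (P_over_t i a) 1)"

definition K_ideal :: "('n::finite, 'r::finite) laurent set" where
  "K_ideal = range (\<lambda>c. \<Sum>i\<in>UNIV. c i * K_relator i)"

lemma K_ideal_0: "0 \<in> K_ideal"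
  unfolding K_ideal_def by (rule range_eqI[where x = "\<lambda>_. 0"]) simp

lemma K_ideal_add: "x \<in> K_ideal \<Longrightarrow> y \<in> K_ideal \<Longrightarrow> x + y \<in> K_ideal"
  unfolding K_ideal_def
proof (elim rangeE)
  fix c d assume "x = (\<Sum>i\<in>UNIV. c i * K_relator i)" "y = (\<Sum>i\<in>UNIV. d i * K_relator i)"
  then show "x + y \<in> range (\<lambda>c. \<Sum>i\<in>UNIV. c i * K_relator i)"
    by (intro range_eqI[where x = "\<lambda>i. c i + d i"]) (simp add: sum.distrib distrib_right)
qed

lemma K_ideal_mult: "x \<in> K_ideal \<Longrightarrow> z * x \<in> K_ideal"
  unfolding K_ideal_def
proof (elim rangeE)
  fix c assume "x = (\<Sum>i\<in>UNIV. c i * K_relator i)"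
  then show "z * x \<in> range (\<lambda>c. \<Sum>i\<in>UNIV. c i * K_relator i)"
    by (intro range_eqI[where x = "\<lambda>i. z * c i"]) (simp add: sum_distrib_left mult.assoc)
qed

lemma K_ideal_minus: "x \<in> K_ideal \<Longrightarrow> - x \<in> K_ideal"
  using K_ideal_mult[of x "-1"] by simp

lemma K_relator_in_ideal: "(K_relator i :: ('n::finite, 'r::finite) laurent) \<in> K_ideal"
  unfolding K_ideal_def
proof (rule range_eqI[where x = "\<lambda>j. if j = i then 1 else 0"])
  have "(\<Sum>j\<in>UNIV. (if j = i then 1 else 0) * (K_relator j :: ('n, 'r) laurent))
      = (\<Sum>j\<in>UNIV. if j = i then K_relator j else 0)"
    by (rule sum.cong) auto
  then show "(K_relator i :: ('n, 'r) laurent) = (\<Sum>j\<in>UNIV. (if j = i then 1 else 0) * K_relator j)"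
    by simp
qed

text \<open>Evaluation homomorphisms, used below only to see that the rings are nonzero.\<close>

definition pm_eval :: "('c::comm_ring_1 \<Rightarrow> 'd::comm_ring_1) \<Rightarrow> ('k::comm_monoid_add \<Rightarrow> 'd) \<Rightarrow> ('k \<Rightarrow>\<^sub>0 'c) \<Rightarrow> 'd"
  where "pm_eval f w x = (\<Sum>k\<in>Poly_Mapping.keys x. f (Poly_Mapping.lookup x k) * w k)"

lemma pm_eval_superset:
  assumes "f 0 = 0" "finite A" "Poly_Mapping.keys x \<subseteq> A"
  shows "pm_eval f w x = (\<Sum>k\<in>A. f (Poly_Mapping.lookup x k) * w k)"
  unfolding pm_eval_def using assms
  by (intro sum.mono_neutral_left) (auto simp: in_keys_iff)

lemma pm_eval_single: "f 0 = 0 \<Longrightarrow> pm_eval f w (Poly_Mapping.single k c) = f c * w k"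
  by (simp add: pm_eval_def)

lemma pm_eval_add:
  assumes "f 0 = 0" "\<And>a b. f (a + b) = f a + f b"
  shows "pm_eval f w (x + y) = pm_eval f w x + pm_eval f w y"
proof -
  let ?A = "Poly_Mapping.keys x \<union> Poly_Mapping.keys y"
  have "pm_eval f w (x + y) = (\<Sum>k\<in>?A. f (Poly_Mapping.lookup (x + y) k) * w k)"
    using keys_add[of x y] by (intro pm_eval_superset assms(1)) auto
  also have "\<dots> = (\<Sum>k\<in>?A. f (Poly_Mapping.lookup x k) * w k) + (\<Sum>k\<in>?A. f (Poly_Mapping.lookup y k) * w k)"
    by (simp add: lookup_add assms(2) distrib_right sum.distrib)
  also have "\<dots> = pm_eval f w x + pm_eval f w y"
    using assms(1) pm_eval_superset[of f ?A x w] pm_eval_superset[of f ?A y w] by simp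
  finally show ?thesis .
qed

lemma pm_eval_zero: "pm_eval f w 0 = 0"
  by (simp add: pm_eval_def)

lemma pm_eval_sum:
  assumes "f 0 = 0" "\<And>a b. f (a + b) = f a + f b"
  shows "pm_eval f w (sum g A) = (\<Sum>x\<in>A. pm_eval f w (g x))"
  by (induction A rule: infinite_finite_induct) (simp_all add: pm_eval_zero pm_eval_add[of f, OF assms])

lemma pm_decompose: "x = (\<Sum>k\<in>Poly_Mapping.keys x. Poly_Mapping.single k (Poly_Mapping.lookup x k))"
proof (rule poly_mapping_eqI)
  fix l
  have "Poly_Mapping.lookup (\<Sum>k\<in>Poly_Mapping.keys x. Poly_Mapping.single k (Poly_Mapping.lookup x k)) l
      = (\<Sum>k\<in>Poly_Mapping.keys x. if k = l then Poly_Mapping.lookup x k else 0)"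
    unfolding lookup_sum by (rule sum.cong) (auto simp: lookup_single when_def)
  also have "\<dots> = Poly_Mapping.lookup x l"
    by (simp add: in_keys_iff)
  finally show "Poly_Mapping.lookup x l = Poly_Mapping.lookup (\<Sum>k\<in>Poly_Mapping.keys x. Poly_Mapping.single k (Poly_Mapping.lookup x k)) l" by simp
qed

lemma pm_eval_mult:
  assumes "f 0 = 0" "\<And>a b. f (a + b) = f a + f b" "\<And>a b. f (a * b) = f a * f b"
    and "\<And>k l. w (k + l) = w k * w l"
  shows "pm_eval f w (x * y) = pm_eval f w x * pm_eval f w y"
proof -
  let ?s = "\<lambda>z k. Poly_Mapping.single k (Poly_Mapping.lookup z k)"
  have "x * y = (\<Sum>k\<in>Poly_Mapping.keys x. ?s x k) * (\<Sum>l\<in>Poly_Mapping.keys y. ?s y l)"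
    using pm_decompose[of x] pm_decompose[of y] by simp
  also have "\<dots> = (\<Sum>k\<in>Poly_Mapping.keys x. \<Sum>l\<in>Poly_Mapping.keys y. Poly_Mapping.single (k + l) (Poly_Mapping.lookup x k * Poly_Mapping.lookup y l))"
    by (simp add: sum_product mult_single)
  finally have "pm_eval f w (x * y)
      = (\<Sum>k\<in>Poly_Mapping.keys x. \<Sum>l\<in>Poly_Mapping.keys y. (f (Poly_Mapping.lookup x k) * w k) * (f (Poly_Mapping.lookup y l) * w l))"
    by (simp add: pm_eval_sum[of f, OF assms(1,2)] pm_eval_single[of f, OF assms(1)] assms(3,4) ac_simps)
  then show ?thesis
    by (simp add: pm_eval_def sum_product)
qed

lemma pm_eval_K_ideal:
  assumes "x \<in> (K_ideal :: ('n::finite, 'r::finite) laurent set)"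
  shows "pm_eval (\<lambda>c. c) (\<lambda>_. 1 :: int) x = 0"
proof -
  let ?e = "pm_eval (\<lambda>c. c) (\<lambda>_. 1 :: int)"
  have m: "?e (u * v) = ?e u * ?e v" for u v :: "('n, 'r) laurent"
    by (rule pm_eval_mult) auto
  have 0: "?e (1 - Poly_Mapping.single k 1) = 0" for k :: "('n, 'r) kgen \<Rightarrow>\<^sub>0 int"
  proof -
    have "1 - Poly_Mapping.single k 1
        = Poly_Mapping.single 0 1 + Poly_Mapping.single k (- 1 :: int)"
      by (simp add: single_uminus)
    then show ?thesis by (simp add: pm_eval_add pm_eval_single del: single_one)
  qed
  obtain a :: 'n where "a \<in> UNIV" by simp
  then have rel: "?e (K_relator i :: ('n, 'r) laurent) = 0" for i
    unfolding K_relator_def by (subst prod.remove[of _ a]) (auto simp: m 0)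
  show ?thesis
    using assms unfolding K_ideal_def by (auto simp: pm_eval_sum m rel)
qed

definition K_eq :: "('n::finite, 'r::finite) laurent \<Rightarrow> ('n, 'r) laurent \<Rightarrow> bool" where
  "K_eq x y \<longleftrightarrow> x - y \<in> K_ideal"

lemma equivp_K_eq: "equivp (K_eq :: ('n::finite, 'r::finite) laurent \<Rightarrow> _)"
proof (rule equivpI)
  show "reflp (K_eq :: ('n, 'r) laurent \<Rightarrow> _)" by (auto simp: reflp_def K_eq_def K_ideal_0)
  show "symp (K_eq :: ('n, 'r) laurent \<Rightarrow> _)"
  proof (rule sympI)
    fix x y :: "('n, 'r) laurent"
    assume "K_eq x y"
    then show "K_eq y x" using K_ideal_minus[of "x - y"] by (simp add: K_eq_def)
  qed
  show "transp (K_eq :: ('n, 'r) laurent \<Rightarrow> _)"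
  proof (rule transpI)
    fix x y z :: "('n, 'r) laurent"
    assume "K_eq x y" "K_eq y z"
    then show "K_eq x z" using K_ideal_add[of "x - y" "y - z"] by (simp add: K_eq_def)
  qed
qed

quotient_type (overloaded) ('n, 'r) KT = "('n::finite, 'r::finite) laurent" / K_eq
  by (rule equivp_K_eq)

instantiation KT :: (finite, finite) comm_ring_1
begin

lift_definition zero_KT :: "('a, 'b) KT" is 0 .
lift_definition one_KT :: "('a, 'b) KT" is 1 .

lift_definition plus_KT :: "('a, 'b) KT \<Rightarrow> ('a, 'b) KT \<Rightarrow> ('a, 'b) KT" is "(+)"
proof -
  fix u v x y :: "('a, 'b) laurent"
  assume "K_eq u v" "K_eq x y"
  then have "(u - v) + (x - y) \<in> K_ideal"
    unfolding K_eq_def by (rule K_ideal_add)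
  then show "K_eq (u + x) (v + y)"
    unfolding K_eq_def by (simp add: algebra_simps)
qed

lift_definition uminus_KT :: "('a, 'b) KT \<Rightarrow> ('a, 'b) KT" is uminus
proof -
  fix x y :: "('a, 'b) laurent"
  assume "K_eq x y"
  then have "- (x - y) \<in> K_ideal"
    unfolding K_eq_def by (rule K_ideal_minus)
  then show "K_eq (- x) (- y)"
    unfolding K_eq_def by (simp add: algebra_simps)
qed

lift_definition minus_KT :: "('a, 'b) KT \<Rightarrow> ('a, 'b) KT \<Rightarrow> ('a, 'b) KT" is "(-)"
proof -
  fix u v x y :: "('a, 'b) laurent"
  assume "K_eq u v" "K_eq x y"
  then have "(u - v) + - (x - y) \<in> K_ideal"
    unfolding K_eq_def by (intro K_ideal_add K_ideal_minus)
  then show "K_eq (u - x) (v - y)"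
    unfolding K_eq_def by (simp add: algebra_simps)
qed

lift_definition times_KT :: "('a, 'b) KT \<Rightarrow> ('a, 'b) KT \<Rightarrow> ('a, 'b) KT" is "(*)"
proof -
  fix u v x y :: "('a, 'b) laurent"
  assume "K_eq u v" "K_eq x y"
  then have "x * (u - v) + v * (x - y) \<in> K_ideal"
    unfolding K_eq_def by (intro K_ideal_add K_ideal_mult)
  then show "K_eq (u * x) (v * y)"
    unfolding K_eq_def by (simp add: algebra_simps)
qed

instance
proof
  fix a b c :: "('a, 'b) KT"
  have refl: "K_eq x x" for x :: "('a, 'b) laurent"
    by (simp add: K_eq_def K_ideal_0)
  show "a * b * c = a * (b * c)" by transfer (simp add: refl mult.assoc)
  show "a * b = b * a" by transfer (simp add: refl mult.commute)
  show "1 * a = a" by transfer (simp add: refl)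
  show "a + b + c = a + (b + c)" by transfer (simp add: refl add.assoc)
  show "a + b = b + a" by transfer (simp add: refl add.commute)
  show "0 + a = a" by transfer (simp add: refl)
  show "- a + a = 0" by transfer (simp add: refl)
  show "a - b = a + - b" by transfer (simp add: refl)
  show "(a + b) * c = a * c + b * c" by transfer (simp add: refl distrib_right)
  show "(0 :: ('a, 'b) KT) \<noteq> 1"
  proof
    assume "(0 :: ('a, 'b) KT) = 1"
    then have "K_eq (0 :: ('a, 'b) laurent) 1" by transfer
    then have "(1 :: ('a, 'b) laurent) \<in> K_ideal"
      using K_ideal_minus[of "- 1"] by (simp add: K_eq_def)
    from pm_eval_K_ideal[OF this] show False
      using pm_eval_single[of "\<lambda>c. c" "\<lambda>_. 1 :: int" "0 :: ('a, 'b) kgen \<Rightarrow>\<^sub>0 int" 1] by simp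
  qed
qed

end

definition KT_of_laurent :: "('n::finite, 'r::finite) laurent \<Rightarrow> ('n, 'r) KT" where
  "KT_of_laurent x = abs_KT x"

lemma KT_of_laurent_hom:
  "KT_of_laurent 1 = 1"
  "KT_of_laurent (x - y) = KT_of_laurent x - KT_of_laurent y"
  "KT_of_laurent (x * y) = KT_of_laurent x * KT_of_laurent y"
  by (simp_all add: KT_of_laurent_def one_KT_def minus_KT.abs_eq times_KT.abs_eq)

text \<open>The class of a Laurent monomial in the \<open>t\<^sub>a\<close> and \<open>P\<^sub>i\<close>.\<close>

definition K_mon :: "(('n, 'r) kgen \<Rightarrow>\<^sub>0 int) \<Rightarrow> ('n::finite, 'r::finite) KT" where
  "K_mon e = KT_of_laurent (Poly_Mapping.single e 1)"

lemma K_mon_0: "K_mon 0 = 1"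
  by (simp add: K_mon_def KT_of_laurent_hom)

lemma K_mon_add: "K_mon (e + f) = K_mon e * K_mon f"
  by (simp add: K_mon_def mult_single flip: KT_of_laurent_hom)

lemma KT_relation:
  "(\<Prod>a\<in>UNIV. 1 - K_mon (P_over_t i a)) = (0 :: ('n::finite, 'r::finite) KT)"
proof -
  have "KT_of_laurent (\<Prod>a\<in>A. 1 - Poly_Mapping.single (P_over_t i a) 1)
      = (\<Prod>a\<in>A. 1 - K_mon (P_over_t i a) :: ('n, 'r) KT)" for A :: "'n set"
    by (induction A rule: infinite_finite_induct) (simp_all add: KT_of_laurent_hom K_mon_def)
  from this[of UNIV] have "(\<Prod>a\<in>UNIV. 1 - K_mon (P_over_t i a)) = KT_of_laurent (K_relator i :: ('n, 'r) laurent)"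
    by (simp add: K_relator_def)
  also have "\<dots> = 0"
    unfolding KT_of_laurent_def zero_KT_def
    by (rule KT.abs_eq_iff[THEN iffD2]) (simp add: K_eq_def K_relator_in_ideal)
  finally show ?thesis .
qed

lift_definition KT_aug :: "('n::finite, 'r::finite) KT \<Rightarrow> int" is "pm_eval (\<lambda>c. c) (\<lambda>_. 1)"
proof -
  fix x y :: "('n, 'r) laurent"
  assume "K_eq x y"
  then have "pm_eval (\<lambda>c. c) (\<lambda>_. 1 :: int) (x - y) = 0"
    unfolding K_eq_def by (rule pm_eval_K_ideal)
  moreover have "pm_eval (\<lambda>c. c) (\<lambda>_. 1 :: int) ((x - y) + y)
      = pm_eval (\<lambda>c. c) (\<lambda>_. 1) (x - y) + pm_eval (\<lambda>c. c) (\<lambda>_. 1) y"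
    by (rule pm_eval_add) auto
  ultimately show "pm_eval (\<lambda>c. c) (\<lambda>_. 1 :: int) x = pm_eval (\<lambda>c. c) (\<lambda>_. 1) y"
    by simp
qed

lemma KT_aug_mon: "KT_aug (K_mon e) = 1"
  by (simp add: K_mon_def KT_of_laurent_def KT_aug.abs_eq pm_eval_single)

lemma KT_aug_hom:
  "KT_aug 0 = 0" "KT_aug (x + y) = KT_aug x + KT_aug y" "KT_aug (x * y) = KT_aug x * KT_aug y"
  by (transfer, simp add: pm_eval_zero pm_eval_add pm_eval_mult)+


section \<open>Adjoining the parameters and localizing\<close>

text \<open>
  Outer polynomial variable y, inner polynomial variable \<open>\<lambda>\<close>, coefficients Laurent
  polynomials in q over the K-ring.
\<close>

type_synonym ('n, 'r) KT_ext = "(int \<Rightarrow>\<^sub>0 ('n, 'r) KT) poly poly"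

definition ext_mon :: "int \<Rightarrow> (('n, 'r) kgen \<Rightarrow>\<^sub>0 int) \<Rightarrow> ('n::finite, 'r::finite) KT_ext" where
  "ext_mon m e = [:[:Poly_Mapping.single m (K_mon e):]:]"

definition lam_ext :: "('n::finite, 'r::finite) KT_ext" where
  "lam_ext = [:[:0, 1:]:]"

definition y_ext :: "('n::finite, 'r::finite) KT_ext" where
  "y_ext = [:0, 1:]"

text \<open>
  The multiplicative set generated by exactly those elements whose inverses occur in the series
  \<open>\<J>\<close> below: the \<open>\<lambda>\<close>-factors are inverted for negative \<open>d\<^sub>i - d\<^sub>j\<close> (hence m \<open>\<le>\<close> 0), the
  \<open>y\<lambda>\<close>-factors for positive \<open>d\<^sub>i - d\<^sub>j\<close> (hence m \<open>\<ge>\<close> 1). The operators need no inverses beyond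
  those of q, \<open>t\<^sub>a\<close> and \<open>P\<^sub>i\<close>.
\<close>

inductive_set denoms :: "('n::finite, 'r::finite) KT_ext set" where
  denoms_one: "1 \<in> denoms"
| denoms_Pt: "s \<in> denoms \<Longrightarrow> m \<ge> 1 \<Longrightarrow> (1 - ext_mon m (P_over_t i a)) * s \<in> denoms"
| denoms_lam: "s \<in> denoms \<Longrightarrow> m \<le> 0 \<Longrightarrow> i \<noteq> j \<Longrightarrow>
    (1 - lam_ext * ext_mon m (P_over_P i j)) * s \<in> denoms"
| denoms_y: "s \<in> denoms \<Longrightarrow> m \<ge> 1 \<Longrightarrow> i \<noteq> j \<Longrightarrow>
    (1 + y_ext * lam_ext * ext_mon m (P_over_P i j)) * s \<in> denoms"

lemma denoms_mult:
  assumes "s \<in> denoms" "u \<in> denoms" shows "s * u \<in> denoms"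
  using assms(1)
proof (induction rule: denoms.induct)
  case denoms_one
  then show ?case using assms(2) by simp
next
  case (denoms_Pt s m i a)
  then show ?case using denoms.denoms_Pt[of "s * u" m i a] by (simp add: mult.assoc)
next
  case (denoms_lam s m i j)
  then show ?case using denoms.denoms_lam[of "s * u" m i j] by (simp add: mult.assoc)
next
  case (denoms_y s m i j)
  then show ?case using denoms.denoms_y[of "s * u" m i j] by (simp add: mult.assoc)
qed

lemma denoms_nonzero:
  assumes "s \<in> (denoms :: ('n::finite, 'r::finite) KT_ext set)"
  shows "s \<noteq> 0"
proof -
  define e :: "(int \<Rightarrow>\<^sub>0 ('n, 'r) KT) \<Rightarrow> rat"
    where "e = pm_eval (\<lambda>c. of_int (KT_aug c)) (\<lambda>k. 2 powi k)"
  define E :: "('n, 'r) KT_ext \<Rightarrow> rat" where "E x = e (coeff (coeff x 0) 0)" for x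
  have e_mult: "e (x * y) = e x * e y" for x y
    unfolding e_def by (rule pm_eval_mult) (auto simp: KT_aug_hom power_int_add)
  have e_add: "e (x + y) = e x + e y" for x y
    unfolding e_def by (rule pm_eval_add) (auto simp: KT_aug_hom)
  have e_single: "e (Poly_Mapping.single m (K_mon k)) = 2 powi m" for m k
    unfolding e_def by (subst pm_eval_single) (auto simp: KT_aug_hom KT_aug_mon)
  have e_0: "e 0 = 0"
    by (simp add: e_def pm_eval_zero)
  have e_1: "e 1 = 1"
    using e_single[of 0 0] by (simp add: K_mon_0)
  have e_diff: "e (x - y) = e x - e y" for x y
    using e_add[of "x - y" y] by simp
  have E_mult: "E (x * y) = E x * E y" for x y
    by (simp add: E_def coeff_mult_0 e_mult)
  have "E s \<noteq> 0"
    using assms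
  proof induction
    case denoms_one
    then show ?case by (simp add: E_def e_1)
  next
    case (denoms_Pt s m i a)
    have "E (1 - ext_mon m (P_over_t i a)) = 1 - 2 powi m"
      by (simp add: E_def ext_mon_def e_diff e_1 e_single)
    moreover have "(2::rat) powi m > 1"
      using denoms_Pt.hyps by (auto simp: power_int_def)
    ultimately show ?case
      using denoms_Pt.IH by (simp add: E_mult)
  next
    case (denoms_lam s m i j)
    then show ?case
      by (simp add: E_mult) (simp add: E_def lam_ext_def ext_mon_def coeff_mult_0 e_1)
  next
    case (denoms_y s m i j)
    then show ?case
      by (simp add: E_mult) (simp add: E_def y_ext_def ext_mon_def coeff_mult_0 e_1)
  qed
  then show ?thesis
    by (auto simp: E_def e_0)
qed

definition loc_eq :: "('n::finite, 'r::finite) KT_ext \<times> ('n, 'r) KT_ext \<Rightarrow>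
    ('n, 'r) KT_ext \<times> ('n, 'r) KT_ext \<Rightarrow> bool" where
  "loc_eq x y \<longleftrightarrow> snd x \<in> denoms \<and> snd y \<in> denoms \<and>
    (\<exists>u\<in>denoms. u * (fst x * snd y) = u * (fst y * snd x))"

lemma part_equivp_loc_eq: "part_equivp (loc_eq :: ('n::finite, 'r::finite) KT_ext \<times> _ \<Rightarrow> _)"
proof (rule part_equivpI)
  show "\<exists>x :: ('n, 'r) KT_ext \<times> _. loc_eq x x"
    by (rule exI[of _ "(0, 1)"]) (auto simp: loc_eq_def intro: denoms_one)
  show "symp (loc_eq :: ('n, 'r) KT_ext \<times> _ \<Rightarrow> _)"
    unfolding symp_def loc_eq_def by metis
  show "transp (loc_eq :: ('n, 'r) KT_ext \<times> _ \<Rightarrow> _)"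
  proof (rule transpI, unfold split_paired_all)
    fix a s b t c v :: "('n, 'r) KT_ext"
    assume "loc_eq (a, s) (b, t)" "loc_eq (b, t) (c, v)"
    then obtain u w where h: "s \<in> denoms" "t \<in> denoms" "v \<in> denoms" "u \<in> denoms" "w \<in> denoms"
      "u * (a * t) = u * (b * s)" "w * (b * v) = w * (c * t)"
      by (auto simp: loc_eq_def)
    have "(u * w * t) * (a * v) = (u * (a * t)) * (w * v)" by (simp add: ac_simps)
    also have "\<dots> = (w * (b * v)) * (u * s)" by (simp only: h(6)) (simp add: ac_simps)
    also have "\<dots> = (u * w * t) * (c * s)" by (simp only: h(7)) (simp add: ac_simps)
    finally show "loc_eq (a, s) (c, v)"
      using h(1-5) denoms_mult unfolding loc_eq_def fst_conv snd_conv by blast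
  qed
qed

quotient_type (overloaded) ('n, 'r) KT_loc =
  "('n::finite, 'r::finite) KT_ext \<times> ('n, 'r) KT_ext" / partial: loc_eq
  by (rule part_equivp_loc_eq)

definition loc_frac :: "('n::finite, 'r::finite) KT_ext \<Rightarrow> ('n, 'r) KT_ext \<Rightarrow> ('n, 'r) KT_loc" where
  "loc_frac a s = abs_KT_loc (if s \<in> denoms then (a, s) else (0, 1))"

lemma loc_eq_refl: "s \<in> denoms \<Longrightarrow> loc_eq (a, s) (a, s)"
  by (auto simp: loc_eq_def intro: denoms_one)

lemma loc_frac_cases:
  obtains a s where "z = loc_frac a s" "s \<in> denoms"
proof -
  obtain a s where as: "rep_KT_loc z = (a, s)" by fastforce
  have "loc_eq (rep_KT_loc z) (rep_KT_loc z)"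
    by (rule Quotient_rep_reflp[OF Quotient_KT_loc])
  then have s: "s \<in> denoms" by (simp add: as loc_eq_def)
  then have "z = loc_frac a s"
    using Quotient_abs_rep[OF Quotient_KT_loc, of z] by (simp add: as loc_frac_def)
  then show ?thesis using s that by blast
qed

lemma loc_frac_eq:
  "s \<in> denoms \<Longrightarrow> t \<in> denoms \<Longrightarrow>
    loc_frac a s = loc_frac b t \<longleftrightarrow> (\<exists>u\<in>denoms. u * (a * t) = u * (b * s))"
  using Quotient_rel[OF Quotient_KT_loc, of "(a, s)" "(b, t)"]
  by (simp add: loc_frac_def loc_eq_refl) (simp add: loc_eq_def)

lemma loc_frac_eqI:
  "s \<in> denoms \<Longrightarrow> t \<in> denoms \<Longrightarrow> a * t = b * s \<Longrightarrow> loc_frac a s = loc_frac b t"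
  by (auto simp: loc_frac_eq intro: denoms_one)

instantiation KT_loc :: (finite, finite) comm_ring_1
begin

definition zero_KT_loc :: "('a, 'b) KT_loc" where "0 = loc_frac 0 1"
definition one_KT_loc :: "('a, 'b) KT_loc" where "1 = loc_frac 1 1"

lift_definition plus_KT_loc :: "('a, 'b) KT_loc \<Rightarrow> ('a, 'b) KT_loc \<Rightarrow> ('a, 'b) KT_loc"
  is "\<lambda>x y. (fst x * snd y + fst y * snd x, snd x * snd y)"
  unfolding split_paired_all
proof -
  fix a s b t c v d w :: "('a, 'b) KT_ext"
  assume "loc_eq (a, s) (b, t)" "loc_eq (c, v) (d, w)"
  then obtain p r where h: "s \<in> denoms" "t \<in> denoms" "v \<in> denoms" "w \<in> denoms"
      "p \<in> denoms" "r \<in> denoms" "p * (a * t) = p * (b * s)" "r * (c * w) = r * (d * v)"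
    by (auto simp: loc_eq_def)
  have "(p * r) * ((a * v + c * s) * (t * w)) = (p * (a * t)) * (r * v * w) + (r * (c * w)) * (p * s * t)"
    by (simp add: algebra_simps)
  also have "\<dots> = (p * r) * ((b * w + d * t) * (s * v))"
    by (simp only: h(7,8)) (simp add: algebra_simps)
  finally show "loc_eq (fst (a, s) * snd (c, v) + fst (c, v) * snd (a, s), snd (a, s) * snd (c, v))
      (fst (b, t) * snd (d, w) + fst (d, w) * snd (b, t), snd (b, t) * snd (d, w))"
    using h(1-6) denoms_mult unfolding loc_eq_def fst_conv snd_conv by blast
qed

lift_definition times_KT_loc :: "('a, 'b) KT_loc \<Rightarrow> ('a, 'b) KT_loc \<Rightarrow> ('a, 'b) KT_loc"
  is "\<lambda>x y. (fst x * fst y, snd x * snd y)"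
  unfolding split_paired_all
proof -
  fix a s b t c v d w :: "('a, 'b) KT_ext"
  assume "loc_eq (a, s) (b, t)" "loc_eq (c, v) (d, w)"
  then obtain p r where h: "s \<in> denoms" "t \<in> denoms" "v \<in> denoms" "w \<in> denoms"
      "p \<in> denoms" "r \<in> denoms" "p * (a * t) = p * (b * s)" "r * (c * w) = r * (d * v)"
    by (auto simp: loc_eq_def)
  have "(p * r) * ((a * c) * (t * w)) = (p * (a * t)) * (r * (c * w))"
    by (simp add: ac_simps)
  also have "\<dots> = (p * r) * ((b * d) * (s * v))"
    by (simp only: h(7,8)) (simp add: ac_simps)
  finally show "loc_eq (fst (a, s) * fst (c, v), snd (a, s) * snd (c, v))
      (fst (b, t) * fst (d, w), snd (b, t) * snd (d, w))"
    using h(1-6) denoms_mult unfolding loc_eq_def fst_conv snd_conv by blast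
qed

definition uminus_KT_loc :: "('a, 'b) KT_loc \<Rightarrow> ('a, 'b) KT_loc"
  where "- x = loc_frac (- 1) 1 * x"

definition minus_KT_loc :: "('a, 'b) KT_loc \<Rightarrow> ('a, 'b) KT_loc \<Rightarrow> ('a, 'b) KT_loc"
  where "x - y = x + - (y :: ('a, 'b) KT_loc)"

lemma loc_frac_add:
  "s \<in> denoms \<Longrightarrow> t \<in> denoms \<Longrightarrow> loc_frac a s + loc_frac b t = loc_frac (a * t + b * s) (s * t)"
  by (simp add: loc_frac_def denoms_mult loc_eq_refl plus_KT_loc.abs_eq)

lemma loc_frac_mult:
  "s \<in> denoms \<Longrightarrow> t \<in> denoms \<Longrightarrow> loc_frac a s * loc_frac b t = loc_frac (a * b) (s * t)"
  by (simp add: loc_frac_def denoms_mult loc_eq_refl times_KT_loc.abs_eq)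

instance
proof
  fix x y z :: "('a, 'b) KT_loc"
  obtain a s where x: "x = loc_frac a s" "s \<in> denoms" by (rule loc_frac_cases)
  obtain b t where y: "y = loc_frac b t" "t \<in> denoms" by (rule loc_frac_cases)
  obtain c u where z: "z = loc_frac c u" "u \<in> denoms" by (rule loc_frac_cases)
  note [simp] = x y z loc_frac_add loc_frac_mult denoms_mult denoms_one
    zero_KT_loc_def one_KT_loc_def uminus_KT_loc_def
  show "x * y * z = x * (y * z)" by (simp add: ac_simps)
  show "x * y = y * x" by (simp add: ac_simps)
  show "1 * x = x" by simp
  show "x + y + z = x + (y + z)" by (simp add: algebra_simps)
  show "x + y = y + x" by (simp add: algebra_simps)
  show "0 + x = x" by simp
  show "- x + x = 0" by (simp, intro loc_frac_eqI) (auto simp: algebra_simps)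
  show "x - y = x + - y" by (simp add: minus_KT_loc_def)
  show "(x + y) * z = x * z + y * z"
    by (simp, intro loc_frac_eqI) (auto simp: algebra_simps)
  show "(0 :: ('a, 'b) KT_loc) \<noteq> 1"
    using denoms_nonzero by (auto simp: loc_frac_eq)
qed

end

text \<open>Inverses of units (and 0 on non-units), so that division and \<^term>\<open>(powi)\<close> are available.\<close>

instantiation KT_loc :: (finite, finite) inverse
begin

definition inverse_KT_loc :: "('a, 'b) KT_loc \<Rightarrow> ('a, 'b) KT_loc" where
  "inverse (x :: ('a, 'b) KT_loc) = (if x dvd 1 then THE z. x * z = 1 else 0)"

definition divide_KT_loc :: "('a, 'b) KT_loc \<Rightarrow> ('a, 'b) KT_loc \<Rightarrow> ('a, 'b) KT_loc" where
  "x div y = x * inverse (y :: ('a, 'b) KT_loc)"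

instance ..

end

lemma KT_loc_inverse_eqI:
  fixes x :: "('n::finite, 'r::finite) KT_loc"
  assumes "x * z = 1" shows "inverse x = z"
proof -
  have "x dvd 1" by (rule dvdI[where k = z]) (simp add: assms)
  moreover have "(THE z. x * z = 1) = z"
  proof (rule the_equality)
    show "x * z = 1" by (rule assms)
  next
    fix w assume w: "x * w = 1"
    have "w = (x * z) * w" by (simp add: assms)
    also have "\<dots> = (x * w) * z" by (simp only: ac_simps)
    also have "\<dots> = z" by (simp add: w)
    finally show "w = z" .
  qed
  ultimately show ?thesis by (simp add: inverse_KT_loc_def)
qed

lemma KT_loc_right_inverse:
  fixes x :: "('n::finite, 'r::finite) KT_loc"
  assumes "x dvd 1" shows "x * inverse x = 1"
proof -
  obtain z where z: "x * z = 1" using dvdE[OF assms] by metis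
  show ?thesis using KT_loc_inverse_eqI[OF z] z by simp
qed

definition loc_of_ext :: "('n::finite, 'r::finite) KT_ext \<Rightarrow> ('n, 'r) KT_loc" where
  "loc_of_ext x = loc_frac x 1"

definition P_cl :: "'r \<Rightarrow> ('n::finite, 'r::finite) KT_loc" where
  "P_cl i = loc_of_ext (ext_mon 0 (Poly_Mapping.single (GP i) 1))"

definition t_wt :: "'n \<Rightarrow> ('n::finite, 'r::finite) KT_loc" where
  "t_wt a = loc_of_ext (ext_mon 0 (Poly_Mapping.single (GT a) 1))"

definition q_par :: "('n::finite, 'r::finite) KT_loc" where
  "q_par = loc_of_ext (ext_mon 1 0)"

definition lam_par :: "('n::finite, 'r::finite) KT_loc" where
  "lam_par = loc_of_ext lam_ext"

definition y_par :: "('n::finite, 'r::finite) KT_loc" where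
  "y_par = loc_of_ext y_ext"

lemma loc_of_ext_hom:
  fixes x y :: "('n::finite, 'r::finite) KT_ext"
  shows "loc_of_ext (0 :: ('n, 'r) KT_ext) = 0" "loc_of_ext (1 :: ('n, 'r) KT_ext) = 1"
  "loc_of_ext (x + y) = loc_of_ext x + loc_of_ext y"
  "loc_of_ext (x * y) = loc_of_ext x * loc_of_ext y"
  "loc_of_ext (x - y) = loc_of_ext x - loc_of_ext y"
proof -
  show add: "loc_of_ext (x + y) = loc_of_ext x + loc_of_ext y" for x y :: "('n, 'r) KT_ext"
    by (simp add: loc_of_ext_def loc_frac_add denoms_one)
  show "loc_of_ext (x - y) = loc_of_ext x - loc_of_ext y"
    using add[of "x - y" y] by simp
qed (simp_all add: loc_of_ext_def loc_frac_mult denoms_one zero_KT_loc_def one_KT_loc_def)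

lemma ext_mon_0: "ext_mon 0 0 = 1"
  by (simp add: ext_mon_def K_mon_0 one_pCons)

lemma ext_mon_add: "ext_mon (m + k) (e + f) = ext_mon m e * ext_mon k f"
  by (simp add: ext_mon_def K_mon_add mult_single)

lemma inverse_ext_mon: "inverse (loc_of_ext (ext_mon m e)) = loc_of_ext (ext_mon (- m) (- e))"
  by (rule KT_loc_inverse_eqI)
    (simp add: ext_mon_0 loc_of_ext_hom flip: loc_of_ext_hom(4) ext_mon_add)

lemma ext_mon_power: "loc_of_ext (ext_mon m e) ^ k = loc_of_ext (ext_mon (int k * m) (\<Sum>i<k. e))"
  by (induction k) (simp_all add: ext_mon_0 loc_of_ext_hom algebra_simps
      flip: loc_of_ext_hom(4) ext_mon_add)

lemma q_par_powi: "q_par powi m = loc_of_ext (ext_mon m 0)"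
  by (auto simp: power_int_def q_par_def inverse_ext_mon ext_mon_power)

lemma q_par_powi_add: "q_par powi (m + k) = q_par powi m * q_par powi k"
  by (simp add: q_par_powi flip: loc_of_ext_hom(4) ext_mon_add)

lemma P_cl_div_t_wt: "P_cl i / t_wt a = loc_of_ext (ext_mon 0 (P_over_t i a))"
  by (simp add: divide_KT_loc_def P_cl_def t_wt_def inverse_ext_mon P_over_t_def
      flip: loc_of_ext_hom(4) ext_mon_add)

lemma P_cl_div_P_cl: "P_cl i / P_cl j = loc_of_ext (ext_mon 0 (P_over_P i j))"
  by (simp add: divide_KT_loc_def P_cl_def inverse_ext_mon P_over_P_def
      flip: loc_of_ext_hom(4) ext_mon_add)

lemma P_cl_unit: "P_cl i dvd 1" and t_wt_unit: "t_wt a dvd 1" and q_par_unit: "q_par dvd 1"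
proof -
  have *: "loc_of_ext (ext_mon m e) dvd 1" for m e
    by (rule dvdI[where k = "loc_of_ext (ext_mon (- m) (- e))"])
      (simp add: ext_mon_0 loc_of_ext_hom flip: loc_of_ext_hom(4) ext_mon_add)
  show "P_cl i dvd 1" "t_wt a dvd 1" "q_par dvd 1"
    by (simp_all add: P_cl_def t_wt_def q_par_def *)
qed

lemma P_cl_relation:
  "(\<Prod>a\<in>UNIV. 1 - P_cl i / t_wt a) = (0 :: ('n::finite, 'r::finite) KT_loc)"
proof -
  have ext: "(\<Prod>a\<in>A. 1 - ext_mon 0 (P_over_t i a))
      = ([:[:Poly_Mapping.single 0 (\<Prod>a\<in>A. 1 - K_mon (P_over_t i a)):]:] :: ('n, 'r) KT_ext)"
    for A :: "'n set"
    by (induction A rule: infinite_finite_induct)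
      (simp_all add: ext_mon_def mult_single single_diff one_pCons algebra_simps)
  have loc: "loc_of_ext (\<Prod>a\<in>A. f a) = (\<Prod>a\<in>A. loc_of_ext (f a))"
    for A :: "'n set" and f :: "'n \<Rightarrow> ('n, 'r) KT_ext"
    by (induction A rule: infinite_finite_induct) (simp_all add: loc_of_ext_hom)
  have "(\<Prod>a\<in>UNIV. 1 - P_cl i / t_wt a)
      = (loc_of_ext (\<Prod>a\<in>UNIV. 1 - ext_mon 0 (P_over_t i a)) :: ('n, 'r) KT_loc)"
    by (simp add: loc P_cl_div_t_wt loc_of_ext_hom)
  also have "\<dots> = 0"
    by (simp add: ext KT_relation loc_of_ext_hom)
  finally show ?thesis .
qed

lemma denoms_unit:
  assumes "s \<in> denoms" shows "loc_of_ext s dvd 1"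
proof (rule dvdI)
  show "1 = loc_of_ext s * loc_frac 1 s"
    using assms by (auto simp: loc_of_ext_def loc_frac_mult denoms_one one_KT_loc_def intro!: loc_frac_eqI)
qed

lemma denominator_Pt_unit:
  assumes "m \<ge> 1" shows "(1 - q_par powi m * (P_cl i / t_wt a) :: ('n::finite, 'r::finite) KT_loc) dvd 1"
proof -
  have "1 - q_par powi m * (P_cl i / t_wt a) = loc_of_ext ((1 - ext_mon m (P_over_t i a)) * 1)"
    using ext_mon_add[of m 0 0 "P_over_t i a"]
    by (simp add: q_par_powi P_cl_div_t_wt loc_of_ext_hom)
  then show ?thesis
    using denoms_unit[OF denoms_Pt[OF denoms_one assms]] by simp
qed

lemma denominator_lam_unit:
  assumes "m \<le> 0" "i \<noteq> j" shows "(1 - q_par powi m * lam_par * (P_cl i / P_cl j) :: ('n::finite, 'r::finite) KT_loc) dvd 1"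
proof -
  have "1 - q_par powi m * lam_par * (P_cl i / P_cl j :: ('n, 'r) KT_loc)
      = loc_of_ext ((1 - lam_ext * ext_mon m (P_over_P i j)) * 1)"
    using arg_cong[OF ext_mon_add[of m 0 0 "P_over_P i j :: ('n, 'r) kgen \<Rightarrow>\<^sub>0 int"], of loc_of_ext]
    by (simp add: q_par_powi P_cl_div_P_cl lam_par_def loc_of_ext_hom ac_simps)
  then show ?thesis
    using denoms_unit[OF denoms_lam[OF denoms_one assms]] by simp
qed

lemma denominator_y_unit:
  assumes "m \<ge> 1" "i \<noteq> j" shows "(1 + y_par * q_par powi m * lam_par * (P_cl i / P_cl j) :: ('n::finite, 'r::finite) KT_loc) dvd 1"
proof -
  have "1 + y_par * q_par powi m * lam_par * (P_cl i / P_cl j :: ('n, 'r) KT_loc)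
      = loc_of_ext ((1 + y_ext * lam_ext * ext_mon m (P_over_P i j)) * 1)"
    using arg_cong[OF ext_mon_add[of m 0 0 "P_over_P i j :: ('n, 'r) kgen \<Rightarrow>\<^sub>0 int"], of loc_of_ext]
    by (simp add: q_par_powi P_cl_div_P_cl lam_par_def y_par_def loc_of_ext_hom ac_simps)
  then show ?thesis
    using denoms_unit[OF denoms_y[OF denoms_one assms]] by simp
qed


section \<open>The series and the operators\<close>

text \<open>
  A formal power series in the \<open>Q\<^sub>i\<close> is its coefficient function on exponents
  \<open>d = (d\<^sub>i)\<^sub>i\<close>.
\<close>

type_synonym ('n, 'r) qseries = "('r \<Rightarrow> nat) \<Rightarrow> ('n, 'r) KT_loc"

text \<open>
  \<open>tail_ratio c k l\<close> is \<open>\<Prod>\<^sub>m\<^sub>\<le>\<^sub>k c\<^sub>m / \<Prod>\<^sub>m\<^sub>\<le>\<^sub>l c\<^sub>m\<close> after cancelling the common factors. A factor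
  is inverted only when it survives in the denominator, which is what makes
  \<open>tail_ratio c 0 k\<close> meaningful for factors with non-positive m that are not invertible.
\<close>

definition tail_ratio ::
    "(int \<Rightarrow> ('n::finite, 'r::finite) KT_loc) \<Rightarrow> int \<Rightarrow> int \<Rightarrow> ('n, 'r) KT_loc" where
  "tail_ratio c k l =
    (if l \<le> k then (\<Prod>m\<in>{l + 1..k}. c m) else (\<Prod>m\<in>{k + 1..l}. inverse (c m)))"

definition calJ :: "('n::finite, 'r::finite) qseries" where
  "calJ = (\<lambda>d.
    (\<Prod>i\<in>UNIV. \<Prod>a\<in>UNIV. \<Prod>m=1..d i.
      (1 + y_par * q_par ^ m * (P_cl i / t_wt a)) / (1 - q_par ^ m * (P_cl i / t_wt a))) *
    (\<Prod>i\<in>UNIV. \<Prod>j\<in>UNIV - {i}.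
      tail_ratio (\<lambda>m. 1 - q_par powi m * lam_par * (P_cl i / P_cl j)) (int (d i) - int (d j)) 0 *
      tail_ratio (\<lambda>m. 1 + y_par * q_par powi m * lam_par * (P_cl i / P_cl j)) 0 (int (d i) - int (d j))))"

text \<open>The operator \<open>Q\<^sub>i \<mapsto> q\<^sup>s Q\<^sub>i\<close>.\<close>

definition q_shift :: "'r \<Rightarrow> int \<Rightarrow> ('n::finite, 'r::finite) qseries \<Rightarrow> ('n, 'r) qseries" where
  "q_shift i s F = (\<lambda>d. q_par powi (s * int (d i)) * F d)"

definition Q_mult :: "'r \<Rightarrow> ('n::finite, 'r::finite) qseries \<Rightarrow> ('n, 'r) qseries" where
  "Q_mult i F = (\<lambda>d. if d i = 0 then 0 else F (d(i := d i - 1)))"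

text \<open>\<open>one_plus c T\<close> is the operator \<open>1 + c T\<close>.\<close>

definition one_plus :: "('n::finite, 'r::finite) KT_loc \<Rightarrow>
    (('n, 'r) qseries \<Rightarrow> ('n, 'r) qseries) \<Rightarrow> ('n, 'r) qseries \<Rightarrow> ('n, 'r) qseries" where
  "one_plus c T F = (\<lambda>d. F d + c * T F d)"

text \<open>\<open>q\<close> to the power \<open>Q\<^sub>i\<partial>\<^bsub>Q\<^sub>i\<^esub> - Q\<^sub>j\<partial>\<^bsub>Q\<^sub>j\<^esub>\<close>\<close>

definition q_shift2 :: "'r \<Rightarrow> 'r \<Rightarrow> ('n::finite, 'r::finite) qseries \<Rightarrow> ('n, 'r) qseries" where
  "q_shift2 i j = q_shift i 1 \<circ> q_shift j (- 1)"

text \<open>The composite of the operators \<open>T b\<close>, with b increasing from left to right.\<close>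

definition op_prod :: "'b::linorder set \<Rightarrow> ('b \<Rightarrow> 's \<Rightarrow> 's) \<Rightarrow> 's \<Rightarrow> 's" where
  "op_prod A T = foldr (\<lambda>b S. T b \<circ> S) (sorted_list_of_set A) id"

definition D_op1 ::
    "'r \<Rightarrow> ('n::{finite,linorder}, 'r::{finite,linorder}) qseries \<Rightarrow> ('n, 'r) qseries" where
  "D_op1 i =
     op_prod (UNIV - {i}) (\<lambda>j. one_plus (y_par * lam_par * (P_cl i / P_cl j)) (q_shift2 i j)) \<circ>
     op_prod (UNIV - {i}) (\<lambda>j. one_plus (- (lam_par * q_par * (P_cl j / P_cl i))) (q_shift2 j i)) \<circ>
     op_prod UNIV (\<lambda>a. one_plus (- (P_cl i / t_wt a)) (q_shift i 1))"

definition D_op2 ::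
    "'r \<Rightarrow> ('n::{finite,linorder}, 'r::{finite,linorder}) qseries \<Rightarrow> ('n, 'r) qseries" where
  "D_op2 i =
     op_prod (UNIV - {i}) (\<lambda>j. one_plus (y_par * lam_par * q_par * (P_cl j / P_cl i)) (q_shift2 j i)) \<circ>
     op_prod UNIV (\<lambda>a. one_plus (y_par * (P_cl i / t_wt a)) (q_shift i 1)) \<circ>
     Q_mult i \<circ>
     op_prod (UNIV - {i}) (\<lambda>j. one_plus (- (lam_par * q_par * (P_cl i / P_cl j))) (q_shift2 i j))"

text \<open>The index 1 of \<open>{1, \<dots>, r}\<close>; the indices \<open>{2, \<dots>, r}\<close> are \<open>UNIV - {first_index}\<close>.\<close>

definition first_index :: "'r::{finite,linorder}" where
  "first_index = Min UNIV"

end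

theory Submission
  imports Defs
begin

text \<open>
  All factors of the two operators other than \<open>Q\<^sub>i\<close> are diagonal on monomials: they multiply the
  coefficient of \<open>Q\<^sup>d\<close> by a scalar obtained from \<open>q\<^bsup>Q\<partial>\<^esup> \<mapsto> q\<^sup>d\<close>. So the equation of operators is, for
  each \<open>d\<close>, a relation between the coefficients of \<open>\<J>\<close> at \<open>d\<close> and at \<open>e = d - \<epsilon>\<^sub>i\<close>, where \<open>\<epsilon>\<^sub>i\<close> is
  the \<open>i\<close>-th unit vector.

  If \<open>d\<^sub>i = 0\<close>, then \<open>Q\<^sub>i\<close> makes the right-hand side vanish, and the left-hand side contains the
  scalar \<open>\<Prod>\<^sub>a (1 - P\<^sub>i/t\<^sub>a)\<close>, which is the relation of the K-ring.

  If \<open>d\<^sub>i \<ge> 1\<close>, passing from \<open>e\<close> to \<open>d\<close> adds one step to the products of index \<open>i\<close>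
  (lemma \<open>calJ_proj_step\<close>) and, for each \<open>j \<noteq> i\<close>, one step to the products of the ordered pairs
  \<open>(i,j)\<close> and \<open>(j,i)\<close>, in opposite directions (lemma \<open>calJ_pair_step\<close>). Formally, the quotient of
  the two coefficients has the scalars of the second operator as its numerator and those of the
  first as its denominator. These denominators need not be invertible, so the relation is proved in
  cross-multiplied form (lemma \<open>calJ_recursion\<close>); for this it is enough that every inverse that
  occurs in \<open>\<J>\<close> is one of an invertible factor.
\<close>

section \<open>Diagonal operators\<close>

lemma op_prod_diagonal:
  fixes w :: "'b::linorder \<Rightarrow> ('r \<Rightarrow> nat) \<Rightarrow> ('n::finite, 'r::finite) KT_loc"
  assumes "finite A" and diag: "\<And>b F d. T b F d = w b d * F d"
  shows "op_prod A T F d = (\<Prod>b\<in>A. w b d) * F d"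
proof -
  have "foldr (\<lambda>b S. T b \<circ> S) xs id F d = prod_list (map (\<lambda>b. w b d) xs) * F d" for xs
    by (induction xs) (simp_all add: diag mult.assoc)
  then have "op_prod A T F d = prod_list (map (\<lambda>b. w b d) (sorted_list_of_set A)) * F d"
    by (simp add: op_prod_def)
  also have "prod_list (map (\<lambda>b. w b d) (sorted_list_of_set A)) = (\<Prod>b\<in>A. w b d)"
    using assms(1) by (simp flip: prod.distinct_set_conv_list)
  finally show ?thesis .
qed

lemma op_prod_q_shift:
  fixes F :: "('n::finite, 'r::finite) qseries"
  assumes "finite A"
  shows "op_prod A (\<lambda>a. one_plus (c a) (q_shift i 1)) F d
    = (\<Prod>a\<in>A. 1 + c a * q_par powi int (d i)) * F d"
  using assms by (intro op_prod_diagonal) (simp_all add: one_plus_def q_shift_def algebra_simps)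

lemma op_prod_q_shift2:
  fixes F :: "('n::finite, 'r::finite) qseries"
  assumes "finite A"
  shows "op_prod A (\<lambda>b. one_plus (c b) (q_shift2 (i b) (j b))) F d
    = (\<Prod>b\<in>A. 1 + c b * q_par powi (int (d (i b)) - int (d (j b)))) * F d"
proof (rule op_prod_diagonal[OF assms])
  fix b and F :: "('n, 'r) qseries" and d
  have "q_par powi (int (d (i b)) - int (d (j b)))
      = (q_par powi int (d (i b)) * q_par powi (- int (d (j b))) :: ('n, 'r) KT_loc)"
    using q_par_powi_add[of "int (d (i b))" "- int (d (j b))"] by simp
  then show "one_plus (c b) (q_shift2 (i b) (j b)) F d
      = (1 + c b * q_par powi (int (d (i b)) - int (d (j b)))) * F d"
    by (simp add: one_plus_def q_shift2_def q_shift_def algebra_simps)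
qed

section \<open>One step in the ratios of products\<close>

text \<open>
  Raising the upper bound of the numerator across the threshold \<open>l\<close> cancels an inverse instead of
  adding a factor; this is where invertibility below \<open>l\<close> enters.
\<close>

lemma tail_ratio_numerator_step:
  assumes unit: "\<And>m. m \<le> l \<Longrightarrow> c m dvd 1"
  shows "tail_ratio c k l = c k * tail_ratio c (k - 1) l"
proof (cases "k \<le> l")
  case True
  then have "{k..l} = insert k {k + 1..l}" by auto
  then have "c k * tail_ratio c (k - 1) l = (c k * inverse (c k)) * (\<Prod>m\<in>{k + 1..l}. inverse (c m))"
    using True by (simp add: tail_ratio_def mult.assoc)
  also have "\<dots> = tail_ratio c k l"
    using True KT_loc_right_inverse[OF unit[OF True]] by (simp add: tail_ratio_def)
  finally show ?thesis by simp
next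
  case False
  then have "{l + 1..k} = insert k {l + 1..k - 1}" by auto
  then show ?thesis using False by (simp add: tail_ratio_def)
qed

lemma tail_ratio_denominator_step:
  assumes unit: "\<And>m. m > l \<Longrightarrow> c m dvd 1"
  shows "tail_ratio c l (k - 1) = c k * tail_ratio c l k"
proof (cases "k > l")
  case True
  then have "{l + 1..k} = insert k {l + 1..k - 1}" by auto
  then have "c k * tail_ratio c l k
      = (c k * inverse (c k)) * (\<Prod>m\<in>{l + 1..k - 1}. inverse (c m))"
    using True by (simp add: tail_ratio_def mult.assoc)
  also have "\<dots> = tail_ratio c l (k - 1)"
    using True KT_loc_right_inverse[OF unit[OF True]] by (simp add: tail_ratio_def)
  finally show ?thesis by simp
next
  case False
  then have "{k..l} = insert k {k + 1..l}" by auto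
  then show ?thesis using False by (simp add: tail_ratio_def)
qed

section \<open>The coefficients of the series\<close>

definition lam_factor :: "'r \<Rightarrow> 'r \<Rightarrow> int \<Rightarrow> ('n::finite, 'r::finite) KT_loc" where
  "lam_factor i j m = 1 - q_par powi m * lam_par * (P_cl i / P_cl j)"

definition y_factor :: "'r \<Rightarrow> 'r \<Rightarrow> int \<Rightarrow> ('n::finite, 'r::finite) KT_loc" where
  "y_factor i j m = 1 + y_par * q_par powi m * lam_par * (P_cl i / P_cl j)"

definition calJ_proj :: "'r \<Rightarrow> nat \<Rightarrow> ('n::finite, 'r::finite) KT_loc" where
  "calJ_proj i k = (\<Prod>a\<in>UNIV. \<Prod>m=1..k.
    (1 + y_par * q_par ^ m * (P_cl i / t_wt a)) / (1 - q_par ^ m * (P_cl i / t_wt a)))"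

definition calJ_pair :: "'r \<Rightarrow> 'r \<Rightarrow> int \<Rightarrow> ('n::finite, 'r::finite) KT_loc" where
  "calJ_pair i j D = tail_ratio (lam_factor i j) D 0 * tail_ratio (y_factor i j) 0 D"

lemma calJ_eq:
  "calJ d = (\<Prod>i\<in>UNIV. calJ_proj i (d i)) *
     (\<Prod>i\<in>UNIV. \<Prod>j\<in>UNIV - {i}. calJ_pair i j (int (d i) - int (d j)))"
  unfolding calJ_def calJ_proj_def calJ_pair_def lam_factor_def y_factor_def ..

text \<open>
  The \<open>\<lambda>\<close>-factors are invertible for \<open>m \<le> 0\<close> and the \<open>y\<close>-factors for \<open>m \<ge> 1\<close>, exactly the ranges in
  which the two ratios invert them. Keeping the factors on opposite sides makes the relation hold
  for every \<open>D\<close>, also where the factor with \<open>m = D\<close> is not invertible. For \<open>(i,j)\<close> it is used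
  upwards with \<open>D = d\<^sub>i - d\<^sub>j\<close>, and for \<open>(j,i)\<close> downwards with \<open>D = d\<^sub>j - d\<^sub>i + 1\<close>.
\<close>

lemma calJ_pair_step:
  assumes "i \<noteq> j"
  shows "y_factor i j D * calJ_pair i j D = lam_factor i j D * calJ_pair i j (D - 1)"
proof -
  have num: "tail_ratio (lam_factor i j) D 0 = lam_factor i j D * tail_ratio (lam_factor i j) (D - 1) 0"
    by (rule tail_ratio_numerator_step)
      (use assms in \<open>simp add: lam_factor_def denominator_lam_unit\<close>)
  have den: "tail_ratio (y_factor i j) 0 (D - 1) = y_factor i j D * tail_ratio (y_factor i j) 0 D"
    by (rule tail_ratio_denominator_step)
      (use assms in \<open>simp add: y_factor_def denominator_y_unit\<close>)
  show ?thesis unfolding calJ_pair_def num den by (simp add: ac_simps)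
qed

lemma calJ_proj_step:
  "(\<Prod>a\<in>UNIV. 1 - q_par powi int (Suc k) * (P_cl i / t_wt a)) * calJ_proj i (Suc k)
   = (\<Prod>a\<in>UNIV. 1 + y_par * q_par powi int (Suc k) * (P_cl i / t_wt a)) *
     (calJ_proj i k :: ('n::finite, 'r::finite) KT_loc)"
proof -
  define N D :: "'n \<Rightarrow> nat \<Rightarrow> ('n, 'r) KT_loc" where
    "N = (\<lambda>a m. 1 + y_par * q_par ^ m * (P_cl i / t_wt a))" and
    "D = (\<lambda>a m. 1 - q_par ^ m * (P_cl i / t_wt a))"
  have step: "D a (Suc k) * (\<Prod>m=1..Suc k. N a m / D a m)
      = N a (Suc k) * (\<Prod>m=1..k. N a m / D a m)" for a
  proof -
    have "D a (Suc k) dvd 1"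
      using denominator_Pt_unit[of "int (Suc k)" i a]
      by (simp add: D_def power_int_of_nat del: of_nat_Suc)
    then have "D a (Suc k) * (N a (Suc k) / D a (Suc k)) = N a (Suc k)"
      using KT_loc_right_inverse[of "D a (Suc k)"]
      by (metis divide_KT_loc_def mult.left_commute mult.right_neutral)
    then show ?thesis by (simp add: ac_simps flip: mult.assoc)
  qed
  then have "(\<Prod>a\<in>UNIV. D a (Suc k)) * (\<Prod>a\<in>UNIV. \<Prod>m=1..Suc k. N a m / D a m)
      = (\<Prod>a\<in>UNIV. N a (Suc k)) * (\<Prod>a\<in>UNIV. \<Prod>m=1..k. N a m / D a m)"
    by (simp only: flip: prod.distrib)
  then show ?thesis
    unfolding calJ_proj_def N_def D_def power_int_of_nat .
qed

lemma prod_ordered_pairs_split: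
  fixes f :: "'b::finite \<Rightarrow> 'b \<Rightarrow> 'c::comm_monoid_mult"
  shows "(\<Prod>i\<in>UNIV. \<Prod>j\<in>UNIV - {i}. f i j)
    = (\<Prod>j\<in>UNIV - {p}. f p j) * (\<Prod>j\<in>UNIV - {p}. f j p) *
      (\<Prod>i\<in>UNIV - {p}. \<Prod>j\<in>UNIV - {i, p}. f i j)"
proof -
  have "(\<Prod>j\<in>UNIV - {i}. f i j) = f i p * (\<Prod>j\<in>UNIV - {i, p}. f i j)" if "i \<in> UNIV - {p}" for i
  proof -
    have "UNIV - {i} - {p} = UNIV - {i, p}" by auto
    then show ?thesis using that prod.remove[of "UNIV - {i}" p "f i"] by auto
  qed
  then have "(\<Prod>i\<in>UNIV - {p}. \<Prod>j\<in>UNIV - {i}. f i j)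
      = (\<Prod>j\<in>UNIV - {p}. f j p) * (\<Prod>i\<in>UNIV - {p}. \<Prod>j\<in>UNIV - {i, p}. f i j)"
    by (simp add: prod.distrib)
  then show ?thesis
    using prod.remove[of UNIV p "\<lambda>i. \<Prod>j\<in>UNIV - {i}. f i j"] by (simp add: mult.assoc)
qed

lemma calJ_recursion:
  fixes d :: "'r::finite \<Rightarrow> nat"
  assumes "d i > 0"
  defines "e \<equiv> d(i := d i - 1)"
  defines "\<delta> \<equiv> \<lambda>j. int (d i) - int (d j)"
  shows "(\<Prod>j\<in>UNIV - {i}. y_factor i j (\<delta> j)) * (\<Prod>j\<in>UNIV - {i}. lam_factor j i (1 - \<delta> j)) *
      (\<Prod>a\<in>UNIV. 1 - q_par powi int (d i) * (P_cl i / t_wt a)) * calJ d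
    = (\<Prod>j\<in>UNIV - {i}. y_factor j i (1 - \<delta> j)) *
      (\<Prod>a\<in>UNIV. 1 + y_par * q_par powi int (d i) * (P_cl i / t_wt a)) *
      (\<Prod>j\<in>UNIV - {i}. lam_factor i j (\<delta> j)) * (calJ e :: ('n::finite, 'r) KT_loc)"
    (is "?Y1 * ?L1 * ?A1 * _ = ?Y2 * ?A2 * ?L2 * _")
proof -
  let ?R = "UNIV - {i}"
  let ?X = "\<lambda>d j k. calJ_pair j k (int (d j) - int (d k)) :: ('n, 'r) KT_loc"
  define B where "B = (\<Prod>j\<in>?R. calJ_proj j (d j) :: ('n, 'r) KT_loc)"
  define C where "C = (\<Prod>j\<in>?R. \<Prod>k\<in>UNIV - {j, i}. ?X d j k)"
  define U where "U = (\<lambda>d. \<Prod>j\<in>?R. ?X d i j)"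
  define V where "V = (\<lambda>d. \<Prod>j\<in>?R. ?X d j i)"
  have d: "calJ d = calJ_proj i (d i) * B * (U d * V d * C)"
    unfolding calJ_eq prod_ordered_pairs_split[of _ i] B_def C_def U_def V_def
    by (subst prod.remove[of UNIV i]) simp_all
  have B_e: "(\<Prod>j\<in>?R. calJ_proj j (e j)) = B"
    unfolding B_def e_def by (rule prod.cong) auto
  have C_e: "(\<Prod>j\<in>?R. \<Prod>k\<in>UNIV - {j, i}. ?X e j k) = C"
    unfolding C_def e_def by (intro prod.cong) auto
  have e: "calJ e = calJ_proj i (d i - 1) * B * (U e * V e * C)"
    unfolding calJ_eq prod_ordered_pairs_split[of _ i] C_e U_def V_def
    by (subst prod.remove[of UNIV i]) (simp_all only: B_e finite_UNIV UNIV_I, simp add: e_def)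
  have proj: "?A1 * calJ_proj i (d i) = ?A2 * calJ_proj i (d i - 1)"
    using calJ_proj_step[of "d i - 1" i] assms(1) by simp
  have up: "?Y1 * U d = ?L2 * U e"
    unfolding U_def prod.distrib[symmetric]
  proof (rule prod.cong)
    fix j assume "j \<in> ?R"
    moreover from this have "int (e i) - int (e j) = \<delta> j - 1"
      using assms(1) by (auto simp: e_def \<delta>_def)
    ultimately show "y_factor i j (\<delta> j) * ?X d i j = lam_factor i j (\<delta> j) * ?X e i j"
      using calJ_pair_step[of i j "\<delta> j"] by (auto simp: \<delta>_def)
  qed simp
  have down: "?L1 * V d = ?Y2 * V e"
    unfolding V_def prod.distrib[symmetric]
  proof (rule prod.cong)
    fix j assume "j \<in> ?R"
    moreover from this have "int (e j) - int (e i) = 1 - \<delta> j"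
      using assms(1) by (auto simp: e_def \<delta>_def)
    moreover have "int (d j) - int (d i) = (1 - \<delta> j) - 1" by (simp add: \<delta>_def)
    ultimately show "lam_factor j i (1 - \<delta> j) * ?X d j i = y_factor j i (1 - \<delta> j) * ?X e j i"
      using calJ_pair_step[of j i "1 - \<delta> j", symmetric] by auto
  qed simp
  have "?Y1 * ?L1 * ?A1 * calJ d = (?A1 * calJ_proj i (d i)) * (?Y1 * U d) * (?L1 * V d) * (B * C)"
    unfolding d by (simp only: ac_simps)
  also have "\<dots> = ?Y2 * ?A2 * ?L2 * calJ e"
    unfolding proj up down e by (simp only: ac_simps)
  finally show ?thesis .
qed

section \<open>The difference equation\<close>

lemma D_op1_coeff:
  fixes F :: "('n::{finite,linorder}, 'r::{finite,linorder}) qseries"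
  defines "\<delta> \<equiv> \<lambda>d i j. int (d i) - int (d j)"
  shows "D_op1 i F d = (\<Prod>j\<in>UNIV - {i}. y_factor i j (\<delta> d i j)) *
      (\<Prod>j\<in>UNIV - {i}. lam_factor j i (1 - \<delta> d i j)) *
      (\<Prod>a\<in>UNIV. 1 - q_par powi int (d i) * (P_cl i / t_wt a)) * F d"
proof -
  have "q_par powi (1 - \<delta> d i j) = q_par * (q_par powi \<delta> d j i :: ('n, 'r) KT_loc)" for j
    using q_par_powi_add[of 1 "\<delta> d j i"] by (simp add: \<delta>_def algebra_simps)
  then show ?thesis
    by (simp add: D_op1_def op_prod_q_shift op_prod_q_shift2 y_factor_def lam_factor_def
        flip: \<delta>_def) (simp add: \<delta>_def ac_simps)
qed

text \<open>
  The rightmost factors of the second operator act before \<open>Q\<^sub>i\<close>, hence on the coefficient at the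
  exponent lowered in direction \<open>i\<close>; the explicit \<open>q\<close> in their scalars undoes this shift, so that
  the exponents are again those of \<open>d\<close>.
\<close>

lemma D_op2_coeff:
  fixes F :: "('n::{finite,linorder}, 'r::{finite,linorder}) qseries"
  assumes "d i > 0"
  defines "\<delta> \<equiv> \<lambda>d i j. int (d i) - int (d j)"
  shows "D_op2 i F d = (\<Prod>j\<in>UNIV - {i}. y_factor j i (1 - \<delta> d i j)) *
      (\<Prod>a\<in>UNIV. 1 + y_par * q_par powi int (d i) * (P_cl i / t_wt a)) *
      (\<Prod>j\<in>UNIV - {i}. lam_factor i j (\<delta> d i j)) * F (d(i := d i - 1))"
proof -
  define e where "e = d(i := d i - 1)"
  have 1: "q_par powi (1 - \<delta> d i j) = q_par * (q_par powi \<delta> d j i :: ('n, 'r) KT_loc)" for j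
    using q_par_powi_add[of 1 "\<delta> d j i"] by (simp add: \<delta>_def algebra_simps)
  have 2: "q_par powi \<delta> d i j = q_par * (q_par powi \<delta> e i j :: ('n, 'r) KT_loc)"
    if "j \<in> UNIV - {i}" for j
    using q_par_powi_add[of 1 "\<delta> e i j"] that assms(1) by (simp add: \<delta>_def e_def of_nat_diff)
  have lam: "(\<Prod>j\<in>UNIV - {i}. lam_factor i j (\<delta> d i j) :: ('n, 'r) KT_loc)
      = (\<Prod>j\<in>UNIV - {i}. 1 + - (lam_par * q_par * (P_cl i / P_cl j)) * q_par powi \<delta> e i j)"
    by (rule prod.cong) (simp_all only: lam_factor_def 2, simp_all add: ac_simps)
  have y: "(\<Prod>j\<in>UNIV - {i}. y_factor j i (1 - \<delta> d i j) :: ('n, 'r) KT_loc)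
      = (\<Prod>j\<in>UNIV - {i}. 1 + y_par * lam_par * q_par * (P_cl j / P_cl i) * q_par powi \<delta> d j i)"
    by (rule prod.cong) (simp_all only: y_factor_def 1, simp_all add: ac_simps)
  have proj: "(\<Prod>a\<in>UNIV. 1 + y_par * q_par powi int (d i) * (P_cl i / t_wt a) :: ('n, 'r) KT_loc)
      = (\<Prod>a\<in>UNIV. 1 + y_par * (P_cl i / t_wt a) * q_par powi int (d i))"
    by (simp only: ac_simps)
  have "Q_mult i G d = G e" for G :: "('n, 'r) qseries"
    using assms(1) by (simp add: Q_mult_def e_def)
  then show ?thesis
    unfolding lam y proj e_def[symmetric]
    by (simp only: D_op2_def o_apply op_prod_q_shift op_prod_q_shift2 finite \<delta>_def mult.assoc)
qed

lemma D_op_calJ: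
  "D_op1 i (calJ :: ('n::{finite,linorder}, 'r::{finite,linorder}) qseries) = D_op2 i calJ"
proof
  fix d
  show "D_op1 i (calJ :: ('n, 'r) qseries) d = D_op2 i calJ d"
  proof (cases "d i = 0")
    case True
    then have "D_op1 i (calJ :: ('n, 'r) qseries) d = 0"
      by (simp add: D_op1_coeff P_cl_relation)
    moreover have "D_op2 i (calJ :: ('n, 'r) qseries) d = 0"
      using True by (simp add: D_op2_def op_prod_q_shift op_prod_q_shift2 Q_mult_def)
    ultimately show ?thesis by simp
  next
    case False
    then show ?thesis
      by (simp only: D_op1_coeff D_op2_coeff calJ_recursion neq0_conv)
  qed
qed

theorem theoremB1:
  shows "D_op1 first_index (calJ :: ('n::{finite,linorder}, 'r::{finite,linorder}) qseries) =
         D_op2 first_index calJ"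
  by (rule D_op_calJ)

end
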